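(* For all integers $m\ge 0$ and $0\le r\le m$ with $r\equiv m\pmod 2$, $$[u^{m-r}]\,\frac{u}{\sin u}(u\cot u)^m=(-1)^{(m-r)/2}\,\frac{r!}{2^r}\,[x^r]q_m(x).$$ Equivalently, for every integer $m\ge0$, $$q_m(x)=\sum_{j=0}^{\lfloor m/2\rfloor}(-1)^j\,\frac{2^{m-2j}}{(m-2j)!}\left([u^{2j}]\,\frac{u}{\sin u}(u\cot u)^m\right)x^{m-2j}.$$
   Context: The polynomials $q_m(x)$, $m\ge0$, are defined by the formal power series identity in $t$ $$\sum_{m=0}^{\infty}q_m(x)t^m=\frac{1}{\sqrt{1-t^2}}\exp\bigl(2x\operatorname{artanh}t\bigr)=(1+t)^{x-1/2}(1-t)^{-x-1/2},$$ where $\operatorname{artanh}t=\sum_{k\ge0}t^{2k+1}/(2k+1)$. The notation $[z^k]F(z)$ denotes the coefficient of $z^k$ in the formal power series $F(z)$ at the origin. Here $u/\sin u$ and $u\cot u=u\cos u/\sin u$ are regarded as formal power series in $u$ (each with constant term $1$). *)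

theory Defs
  imports
    "HOL-Computational_Algebra.Polynomial"
    "HOL-Computational_Algebra.Formal_Power_Series"
    "HOL-Number_Theory.Cong"
begin

text \<open>
  The generating function is a power series in \<open>t\<close> (the variable \<open>fps_X\<close>) with coefficients in
  the polynomial ring in \<open>x\<close>, i.e. an element of \<open>'a poly fps\<close>. Polynomials do not form a field, so
  the series in \<open>t\<close> alone are built over the field \<open>'a\<close> and then embedded coefficientwise.
\<close>

definition fps_const_poly :: "'a::zero fps \<Rightarrow> 'a poly fps" where
  "fps_const_poly F = Abs_fps (\<lambda>n. [:fps_nth F n:])"

definition fps_artanh :: "'a::field_char_0 fps" where
  "fps_artanh = Abs_fps (\<lambda>n. if odd n then 1 / of_nat n else 0)"

text \<open>\<open>fps_binomial c\<close> is \<open>(1 + t)\<^sup>c\<close>, so this is the square root with constant term \<open>1\<close>.\<close>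

definition fps_sqrt_one_minus_square :: "'a::field_char_0 fps" where
  "fps_sqrt_one_minus_square = fps_binomial (1 / 2) oo (- (fps_X ^ 2))"

text \<open>The polynomial \<open>[:0, 2:]\<close> is \<open>2x\<close>.\<close>

definition q_genfun :: "'a::field_char_0 poly fps" where
  "q_genfun =
     fps_const_poly (inverse fps_sqrt_one_minus_square) *
     (fps_const_poly (fps_exp 1) oo (fps_const [:0, 2:] * fps_const_poly fps_artanh))"

definition q :: "nat \<Rightarrow> 'a::field_char_0 poly" where
  "q m = fps_nth q_genfun m"

text \<open>
  In these quotients of power series numerator and denominator both have subdegree \<open>1\<close>; division
  of power series cancels the factor \<open>u\<close>.
\<close>

definition u_over_sin :: "'a::field_char_0 fps" where
  "u_over_sin = fps_X / fps_sin 1"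

definition u_cot :: "'a::field_char_0 fps" where
  "u_cot = fps_X * fps_cos 1 / fps_sin 1"

lemma u_over_sin_times_sin: "u_over_sin * fps_sin 1 = (fps_X :: 'a::field_char_0 fps)"
proof -
  have "subdegree (fps_sin (1::'a)) = 1" by (rule subdegreeI) (auto simp: fps_sin_def)
  moreover have "fps_sin (1::'a) \<noteq> 0" using calculation by auto
  ultimately have "fps_sin (1::'a) dvd fps_X" by (simp add: fps_dvd_iff)
  thus ?thesis by (simp add: u_over_sin_def)
qed

lemma u_cot_times_sin: "u_cot * fps_sin 1 = (fps_X * fps_cos 1 :: 'a::field_char_0 fps)"
proof -
  have "subdegree (fps_sin (1::'a)) = 1" by (rule subdegreeI) (auto simp: fps_sin_def)
  moreover have "fps_sin (1::'a) \<noteq> 0" using calculation by auto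
  ultimately have "fps_sin (1::'a) dvd fps_X" by (simp add: fps_dvd_iff)
  thus ?thesis by (simp add: u_cot_def)
qed

lemma u_over_sin_nth_0: "fps_nth (u_over_sin :: 'a::field_char_0 fps) 0 = 1"
proof -
  have "fps_nth (u_over_sin * fps_sin (1::'a)) 1 = 1" by (simp add: u_over_sin_times_sin)
  thus ?thesis by (simp add: fps_mult_nth fps_sin_def)
qed

lemma u_cot_nth_0: "fps_nth (u_cot :: 'a::field_char_0 fps) 0 = 1"
proof -
  have "fps_nth (u_cot * fps_sin (1::'a)) 1 = 1"
    by (simp add: u_cot_times_sin fps_cos_def)
  thus ?thesis by (simp add: fps_mult_nth fps_sin_def)
qed

lemma fps_binomial_half_square:
  "fps_binomial (1 / 2) ^ 2 = (1 + fps_X :: 'a::field_char_0 fps)"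
  by (simp add: fps_binomial_power fps_binomial_1)

lemma fps_sqrt_one_minus_square_power2:
  "fps_sqrt_one_minus_square ^ 2 = (1 - fps_X ^ 2 :: 'a::field_char_0 fps)"
proof -
  have "fps_sqrt_one_minus_square ^ 2 =
      (fps_binomial (1 / 2) ^ 2 oo (- (fps_X ^ 2)) :: 'a fps)"
    unfolding fps_sqrt_one_minus_square_def by (rule fps_compose_power) simp
  thus ?thesis
    by (simp add: fps_binomial_half_square fps_compose_add_distrib)
qed

lemma fps_sqrt_one_minus_square_nth_0:
  "fps_nth (fps_sqrt_one_minus_square :: 'a::field_char_0 fps) 0 = 1"
  by (simp add: fps_sqrt_one_minus_square_def)

text \<open>
  For every value of \<open>x\<close>, the values \<open>q\<^sub>m(x)\<close> are the coefficients of both expressions for the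
  generating function, read as power series over the field.
\<close>

lemma poly_mult_nth:
  fixes F G :: "'a::field_char_0 poly fps"
  shows "Abs_fps (\<lambda>n. poly (fps_nth (F * G) n) x) =
         Abs_fps (\<lambda>n. poly (fps_nth F n) x) * Abs_fps (\<lambda>n. poly (fps_nth G n) x)"
  by (rule fps_ext) (simp add: fps_mult_nth poly_sum)

lemma poly_power_nth:
  fixes F :: "'a::field_char_0 poly fps"
  shows "Abs_fps (\<lambda>n. poly (fps_nth (F ^ k) n) x) = Abs_fps (\<lambda>n. poly (fps_nth F n) x) ^ k"
proof (induction k)
  case 0
  show ?case by (rule fps_ext) simp
next
  case (Suc k)
  thus ?case by (simp add: poly_mult_nth)
qed

lemma poly_compose_nth:
  fixes F G :: "'a::field_char_0 poly fps"
  shows "Abs_fps (\<lambda>n. poly (fps_nth (F oo G) n) x) =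
         Abs_fps (\<lambda>n. poly (fps_nth F n) x) oo Abs_fps (\<lambda>n. poly (fps_nth G n) x)"
proof (rule fps_ext)
  fix n
  have "poly (fps_nth (G ^ i) n) x = fps_nth (Abs_fps (\<lambda>n. poly (fps_nth G n) x) ^ i) n" for i
    by (simp flip: poly_power_nth)
  thus "fps_nth (Abs_fps (\<lambda>n. poly (fps_nth (F oo G) n) x)) n =
        fps_nth (Abs_fps (\<lambda>n. poly (fps_nth F n) x) oo Abs_fps (\<lambda>n. poly (fps_nth G n) x)) n"
    by (simp add: fps_compose_nth poly_sum)
qed

lemma poly_const_poly_nth:
  "Abs_fps (\<lambda>n. poly (fps_nth (fps_const_poly F) n) x) = (F :: 'a::field_char_0 fps)"
  by (rule fps_ext) (simp add: fps_const_poly_def)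

lemma poly_q_genfun:
  fixes x :: "'a::field_char_0"
  shows "Abs_fps (\<lambda>m. poly (q m) x) =
         inverse fps_sqrt_one_minus_square * (fps_exp 1 oo (fps_const (2 * x) * fps_artanh))"
proof -
  have c: "Abs_fps (\<lambda>n. poly (fps_nth (fps_const [:0, 2:]) n) x) = fps_const (2 * x)"
    by (rule fps_ext) simp
  show ?thesis
    unfolding q_def q_genfun_def poly_mult_nth poly_compose_nth poly_const_poly_nth c ..
qed

lemma fps_deriv_artanh:
  "(1 - fps_X ^ 2) * fps_deriv fps_artanh = (1 :: 'a::field_char_0 fps)"
proof -
  have "fps_deriv fps_artanh = Abs_fps (\<lambda>n. if even n then 1 else 0 :: 'a)"
    by (rule fps_ext) (simp add: fps_artanh_def del: of_nat_Suc)
  moreover have "(1 - fps_X ^ 2) * Abs_fps (\<lambda>n. if even n then 1 else 0 :: 'a) = 1"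
    by (rule fps_ext) (auto simp: left_diff_distrib fps_X_power_mult_nth
        less_2_cases_iff)
  ultimately show ?thesis by simp
qed

lemma fps_linear_ode_unique:
  fixes D F G H :: "'a::field_char_0 fps"
  assumes F: "D * fps_deriv F = H * F" and G: "D * fps_deriv G = H * G"
    and 0: "fps_nth F 0 = fps_nth G 0" and nz: "fps_nth G 0 \<noteq> 0" and D: "D \<noteq> 0"
  shows "F = G"
proof -
  have i: "inverse G * G = 1" using nz by (rule inverse_mult_eq_1)
  have "D * fps_deriv (F * inverse G) =
      (D * fps_deriv F) * inverse G - F * (D * fps_deriv G) * (inverse G) ^ 2"
    using nz by (simp add: fps_inverse_deriv algebra_simps)
  also have "\<dots> = H * F * inverse G * (1 - inverse G * G)"
    unfolding F G by (simp add: power2_eq_square algebra_simps)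
  also have "\<dots> = 0" by (simp add: i)
  finally have "fps_deriv (F * inverse G) = 0" using D by simp
  hence "F * inverse G = fps_const (fps_nth (F * inverse G) 0)"
    by (simp only: fps_deriv_eq_0_iff)
  hence "F * inverse G = 1" using nz 0 by simp
  hence "F * (inverse G * G) = G" by (simp flip: mult.assoc)
  thus ?thesis by (simp add: i)
qed

lemma poly_q_genfun_binomial:
  fixes x :: "'a::field_char_0"
  shows "Abs_fps (\<lambda>m. poly (q m) x) =
         fps_binomial (x - 1 / 2) * (fps_binomial (- x - 1 / 2) oo (- fps_X))"
    (is "_ = ?B * ?C")
proof -
  define D :: "'a fps" where "D = 1 - fps_X ^ 2"
  define S :: "'a fps" where "S = fps_sqrt_one_minus_square"
  define E where "E = (fps_exp 1 oo (fps_const (2 * x) * fps_artanh))"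
  have S2: "S ^ 2 = D" by (simp add: S_def D_def fps_sqrt_one_minus_square_power2)
  have S0: "fps_nth S 0 = 1" by (simp add: S_def fps_sqrt_one_minus_square_nth_0)
  have i: "inverse S * S = 1" using S0 by (simp add: inverse_mult_eq_1)
  have "fps_nth D 0 \<noteq> 0" by (simp add: D_def)
  hence D: "D \<noteq> 0" by auto
  have dE: "D * fps_deriv E = fps_const (2 * x) * E"
  proof -
    have "fps_deriv E = E * (fps_const (2 * x) * fps_deriv fps_artanh)"
      unfolding E_def by (subst fps_compose_deriv) (simp_all add: fps_artanh_def)
    thus ?thesis using fps_deriv_artanh[where 'a='a] by (simp add: D_def mult.left_commute mult.commute)
  qed
  have dS: "D * fps_deriv (inverse S) = fps_X * inverse S"
  proof -
    have "fps_deriv (S ^ 2) = - (2 * fps_X)"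
      unfolding S2 D_def by (simp add: fps_deriv_power fps_numeral_fps_const)
    hence "2 * (S * fps_deriv S) = 2 * (- fps_X)"
      by (simp add: power2_eq_square mult.commute)
    hence SS: "S * fps_deriv S = - fps_X" by (subst (asm) mult_left_cancel) auto
    have "D * fps_deriv (inverse S) = - (S * fps_deriv S) * (inverse S * S) * inverse S"
      using S0 by (simp add: fps_inverse_deriv power2_eq_square algebra_simps flip: S2)
    thus ?thesis unfolding SS i by simp
  qed
  have dB: "(1 + fps_X) * fps_deriv (fps_binomial c) = fps_const c * fps_binomial c" for c :: 'a
  proof -
    have u: "inverse (1 + fps_X) * (1 + fps_X) = (1 :: 'a fps)" by (rule inverse_mult_eq_1) simp
    have "(1 + fps_X) * fps_deriv (fps_binomial c) =
        fps_const c * fps_binomial c * (inverse (1 + fps_X) * (1 + fps_X))"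
      by (simp add: fps_binomial_deriv fps_divide_unit mult.assoc mult.left_commute mult.commute)
    thus ?thesis unfolding u by simp
  qed
  have dC: "(1 - fps_X) * fps_deriv ?C = fps_const (x + 1 / 2) * ?C"
  proof -
    have "((1 + fps_X) * fps_deriv (fps_binomial (- x - 1 / 2))) oo (- fps_X) =
        (fps_const (- x - 1 / 2) * fps_binomial (- x - 1 / 2)) oo (- fps_X)"
      by (simp only: dB)
    hence "(1 - fps_X) * (fps_deriv (fps_binomial (- x - 1 / 2)) oo (- fps_X)) =
        fps_const (- x - 1 / 2) * ?C"
      by (simp add: fps_compose_mult_distrib fps_compose_add_distrib)
    moreover have "fps_deriv ?C = - (fps_deriv (fps_binomial (- x - 1 / 2)) oo (- fps_X))"
      by (subst fps_compose_deriv) simp_all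
    moreover have "fps_const (x + 1 / 2) = - fps_const (- x - 1 / 2)" by (simp add: add.commute)
    ultimately show ?thesis by (simp only: mult_minus_right mult_minus_left)
  qed
  have "inverse S * E = ?B * ?C"
  proof (rule fps_linear_ode_unique)
    have "D * fps_deriv (inverse S * E) =
        (D * fps_deriv (inverse S)) * E + inverse S * (D * fps_deriv E)"
      by (simp add: algebra_simps)
    also have "\<dots> = (fps_const (2 * x) + fps_X) * (inverse S * E)"
      unfolding dE dS by (simp add: algebra_simps)
    finally show "D * fps_deriv (inverse S * E) = (fps_const (2 * x) + fps_X) * (inverse S * E)" .
    have D': "D = (1 - fps_X) * (1 + fps_X)" by (simp add: D_def power2_eq_square algebra_simps)
    have "D * fps_deriv (?B * ?C) =
        (1 - fps_X) * ((1 + fps_X) * fps_deriv ?B) * ?C +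
        (1 + fps_X) * ?B * ((1 - fps_X) * fps_deriv ?C)"
      unfolding D' fps_deriv_mult by algebra
    also have "\<dots> = ((1 - fps_X) * fps_const (x - 1 / 2) + (1 + fps_X) * fps_const (x + 1 / 2)) *
        (?B * ?C)"
      unfolding dB dC by algebra
    also have "(1 - fps_X) * fps_const (x - 1 / 2) + (1 + fps_X) * fps_const (x + 1 / 2) =
        fps_const (2 * x) + fps_X"
    proof (rule fps_ext)
      fix n
      show "fps_nth ((1 - fps_X) * fps_const (x - 1 / 2) + (1 + fps_X) * fps_const (x + 1 / 2)) n =
          fps_nth (fps_const (2 * x) + fps_X) n"
        by (auto simp: algebra_simps)
    qed
    finally show "D * fps_deriv (?B * ?C) = (fps_const (2 * x) + fps_X) * (?B * ?C)" .
  qed (use S0 D in \<open>auto simp: E_def\<close>)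
  thus ?thesis by (simp add: poly_q_genfun S_def E_def)
qed

end

theory Submission
  imports Defs
begin

text \<open>
  Comparing coefficients, both sides satisfy the same three-term recurrence in \<open>m\<close> and \<open>r\<close>, up to
  the sign and the factor \<open>r! / 2\<^sup>r\<close>. The generating function \<open>Q\<close> of the polynomials
  satisfies \<open>(1 - t\<^sup>2) Q' = (t + 2 x) Q\<close>, hence \<open>(m + 1) q\<^sub>m\<^sub>+\<^sub>1 = 2 x q\<^sub>m + m q\<^sub>m\<^sub>-\<^sub>1\<close>. On the other
  side, \<open>g\<^sub>m = cos\<^sup>m / sin\<^sup>m\<^sup>+\<^sup>1\<close> satisfies \<open>g\<^sub>m' = - m g\<^sub>m\<^sub>-\<^sub>1 - (m + 1) g\<^sub>m\<^sub>+\<^sub>1\<close>, and the series in question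
  is \<open>u\<^sup>m\<^sup>+\<^sup>1 g\<^sub>m\<close>.
\<close>

section \<open>Differential equation and recurrence for the polynomials\<close>

lemma fps_binomial_ode:
  "(1 + fps_X) * fps_deriv (fps_binomial c) = fps_const c * fps_binomial (c :: 'a::field_char_0)"
proof -
  have u: "inverse (1 + fps_X) * (1 + fps_X) = (1 :: 'a fps)"
    by (rule inverse_mult_eq_1) simp
  have "(1 + fps_X) * fps_deriv (fps_binomial c) =
      fps_const c * fps_binomial c * (inverse (1 + fps_X) * (1 + fps_X))"
    by (simp add: fps_binomial_deriv fps_divide_unit mult_ac)
  thus ?thesis unfolding u by simp
qed

lemma fps_binomial_minus_X_ode:
  fixes c :: "'a::field_char_0"
  shows "(1 - fps_X) * fps_deriv (fps_binomial c oo - fps_X) =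
    fps_const (- c) * (fps_binomial c oo - fps_X)"
proof -
  have "((1 + fps_X) * fps_deriv (fps_binomial c)) oo - fps_X =
      (fps_const c * fps_binomial c) oo - fps_X"
    by (simp only: fps_binomial_ode)
  hence "(1 - fps_X) * (fps_deriv (fps_binomial c) oo - fps_X) =
      fps_const c * (fps_binomial c oo - fps_X)"
    by (simp add: fps_compose_mult_distrib fps_compose_add_distrib)
  moreover have "fps_deriv (fps_binomial c oo - fps_X) = - (fps_deriv (fps_binomial c) oo - fps_X)"
    by (subst fps_compose_deriv) simp_all
  ultimately show ?thesis
    by (simp flip: fps_const_neg)
qed

text \<open>Product rule for (1 + t)^(x - 1/2) (1 - t)^(-x - 1/2), whose factors each obey a
  first-order equation. Fixing x keeps the coefficients in a field.\<close>

lemma poly_q_ode: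
  fixes x :: "'a::field_char_0"
  defines "Q \<equiv> Abs_fps (\<lambda>m. poly (q m) x)"
  shows "(1 - fps_X ^ 2) * fps_deriv Q = (fps_const (2 * x) + fps_X) * Q"
proof -
  define B C where "B = fps_binomial (x - 1 / 2)" and "C = fps_binomial (- x - 1 / 2) oo - fps_X"
  have Q: "Q = B * C"
    by (simp add: Q_def B_def C_def poly_q_genfun_binomial)
  have dB: "(1 + fps_X) * fps_deriv B = fps_const (x - 1 / 2) * B"
    unfolding B_def by (rule fps_binomial_ode)
  have dC: "(1 - fps_X) * fps_deriv C = fps_const (x + 1 / 2) * C"
    using fps_binomial_minus_X_ode[of "- x - 1 / 2"] by (simp add: C_def add.commute)
  have "(1 - fps_X ^ 2) * fps_deriv Q =
      (1 - fps_X) * ((1 + fps_X) * fps_deriv B) * C + (1 + fps_X) * B * ((1 - fps_X) * fps_deriv C)"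
    unfolding Q fps_deriv_mult by algebra
  also have "\<dots> = ((1 - fps_X) * fps_const (x - 1 / 2) + (1 + fps_X) * fps_const (x + 1 / 2)) *
      (B * C)"
    unfolding dB dC by algebra
  also have "(1 - fps_X) * fps_const (x - 1 / 2) + (1 + fps_X) * fps_const (x + 1 / 2) =
      fps_const (2 * x) + fps_X"
    by (rule fps_ext) (auto simp: algebra_simps)
  finally show ?thesis unfolding Q .
qed

lemma q_0: "q 0 = (1 :: 'a::field_char_0 poly)"
proof -
  \<comment> \<open>Equal values at every x suffice, since a field of characteristic 0 is
    infinite.\<close>
  have "poly (q 0) x = poly 1 x" for x :: 'a
    using arg_cong[OF poly_q_genfun_binomial[of x], of "\<lambda>F. fps_nth F 0"] by simp
  thus ?thesis by (simp add: poly_eq_poly_eq_iff[symmetric] fun_eq_iff)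
qed

text \<open>Coefficient of t^m in the differential equation, for every value of x. At m = 0 the
  truncated \<open>m - 1\<close> is harmless, as its factor is 0.\<close>

lemma q_Suc:
  "of_nat (Suc m) * q (Suc m) = [:0, 2:] * q m + of_nat m * (q (m - 1) :: 'a::field_char_0 poly)"
proof -
  have "poly (of_nat (Suc m) * q (Suc m)) x = poly ([:0, 2:] * q m + of_nat m * q (m - 1)) x"
    for x :: 'a
  proof -
    have "fps_nth ((1 - fps_X ^ 2) * fps_deriv (Abs_fps (\<lambda>m. poly (q m) x))) m =
        fps_nth ((fps_const (2 * x) + fps_X) * Abs_fps (\<lambda>m. poly (q m) x)) m"
      by (simp only: poly_q_ode)
    \<comment> \<open>The factor t^2 shifts by two places, so the two lowest coefficients are
      treated apart.\<close>
    moreover have "m = 0 \<or> m = 1 \<or> (\<exists>k. m = Suc (Suc k))" by presburger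
    ultimately show ?thesis
      by (auto simp: algebra_simps fps_X_power_mult_nth)
  qed
  hence "poly (of_nat (Suc m) * q (Suc m)) = poly ([:0, 2:] * q m + of_nat m * (q (m - 1) :: 'a poly))"
    by (rule ext)
  thus ?thesis by (simp only: poly_eq_poly_eq_iff)
qed

lemma coeff_q_Suc:
  "of_nat (Suc m) * coeff (q (Suc m) :: 'a::field_char_0 poly) r =
    (if r = 0 then 0 else 2 * coeff (q m) (r - 1)) + of_nat m * coeff (q (m - 1)) r"
proof -
  have of_nat: "coeff (of_nat k * p) r = of_nat k * coeff p r" for k and p :: "'a poly"
    by (simp add: of_nat_poly)
  show ?thesis
    using arg_cong[OF q_Suc[of m, where 'a='a], of "\<lambda>p. coeff p r"]
    unfolding coeff_add of_nat by (cases r) (simp_all del: of_nat_Suc)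
qed

text \<open>The recurrence raises m by one together with r, or m by two with r fixed. Both moves
  preserve the parity of m + r and the bound r \<le> m, starting from
  \<open>q 0 = 1\<close>.\<close>

lemma coeff_q_eq_0:
  assumes "m < r \<or> odd (m + r)"
  shows "coeff (q m :: 'a::field_char_0 poly) r = 0"
  using assms
proof (induction m arbitrary: r rule: less_induct)
  case (less m)
  show ?case
  proof (cases m)
    case 0
    thus ?thesis using less.prems by (auto simp: q_0 dest: odd_pos)
  next
    case (Suc k)
    have "r \<noteq> 0 \<Longrightarrow> coeff (q k :: 'a poly) (r - 1) = 0"
      by (rule less.IH) (use Suc less.prems in \<open>auto\<close>)
    moreover have "k \<noteq> 0 \<Longrightarrow> coeff (q (k - 1) :: 'a poly) r = 0"
      by (rule less.IH) (use Suc less.prems in \<open>auto\<close>)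
    ultimately have "of_nat (Suc k) * coeff (q (Suc k) :: 'a poly) r = 0"
      by (subst coeff_q_Suc) auto
    thus ?thesis using Suc by (simp del: of_nat_Suc)
  qed
qed

section \<open>Differential equations for u / sin u and u cot u\<close>

lemma fps_sin_1_neq_0: "fps_sin (1 :: 'a::field_char_0) \<noteq> 0"
proof
  assume "fps_sin (1 :: 'a) = 0"
  hence "fps_nth (fps_sin (1 :: 'a)) 1 = 0" by simp
  thus False by (simp add: fps_sin_def)
qed

text \<open>Differentiating \<open>u_over_sin * fps_sin 1 = fps_X\<close> avoids quotients. The
  extra factor \<open>fps_X\<close> turns the cosine into \<open>u_cot * fps_sin 1\<close>, after
  which the sine cancels.\<close>

lemma fps_deriv_u_over_sin:
  "fps_X * fps_deriv u_over_sin = u_over_sin * (1 - u_cot :: 'a::field_char_0 fps)"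
proof -
  let ?w = "u_over_sin :: 'a fps" and ?s = "fps_sin (1 :: 'a)" and ?c = "fps_cos (1 :: 'a)"
  have "fps_deriv (?w * ?s) = 1" by (simp add: u_over_sin_times_sin)
  hence "fps_deriv ?w * ?s = 1 - ?w * ?c"
    by (simp add: fps_sin_deriv algebra_simps)
  hence "fps_X * (fps_deriv ?w * ?s) = fps_X * (1 - ?w * ?c)" by simp
  hence "fps_X * fps_deriv ?w * ?s = fps_X - ?w * (fps_X * ?c)"
    by (simp only: algebra_simps mult_1_right)
  also have "\<dots> = ?w * (1 - u_cot) * ?s"
    unfolding u_cot_times_sin[symmetric] by (simp add: algebra_simps u_over_sin_times_sin)
  finally show ?thesis using fps_sin_1_neq_0[where 'a='a] by simp
qed

text \<open>Obtained in the same way from \<open>u_cot * fps_sin 1 = fps_X * fps_cos 1\<close>; the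
  term \<open>fps_X ^ 2\<close> stems from the derivative of the cosine.\<close>

lemma fps_deriv_u_cot:
  "fps_X * fps_deriv u_cot = u_cot - u_cot ^ 2 - (fps_X ^ 2 :: 'a::field_char_0 fps)"
proof -
  let ?v = "u_cot :: 'a fps" and ?s = "fps_sin (1 :: 'a)" and ?c = "fps_cos (1 :: 'a)"
  have "fps_deriv (?v * ?s) = ?c - fps_X * ?s"
    by (simp add: u_cot_times_sin fps_cos_deriv flip: fps_const_neg)
  hence "fps_deriv ?v * ?s = ?c - fps_X * ?s - ?v * ?c"
    by (simp add: fps_sin_deriv algebra_simps)
  hence "fps_X * (fps_deriv ?v * ?s) = fps_X * (?c - fps_X * ?s - ?v * ?c)"
    by simp
  hence "fps_X * fps_deriv ?v * ?s = (fps_X * ?c) - fps_X ^ 2 * ?s - ?v * (fps_X * ?c)"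
    by (simp only: algebra_simps power2_eq_square)
  also have "\<dots> = (?v - ?v ^ 2 - fps_X ^ 2) * ?s"
    unfolding u_cot_times_sin[symmetric] by (simp add: algebra_simps power2_eq_square)
  finally show ?thesis using fps_sin_1_neq_0[where 'a='a] by simp
qed

text \<open>With \<open>G m\<close> read as u^(m+1) times g_m, the first term comes from
  differentiating the power of u and the other two from the derivative of g_m. Formally it is the
  product rule with the two preceding equations.\<close>

lemma fps_deriv_u_over_sin_cot_power:
  fixes G :: "nat \<Rightarrow> 'a::field_char_0 fps"
  defines "G \<equiv> \<lambda>m. u_over_sin * u_cot ^ m"
  shows "fps_X * fps_deriv (G m) =
    of_nat (Suc m) * G m - of_nat m * (fps_X ^ 2 * G (m - 1)) - of_nat (Suc m) * G (Suc m)"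
proof -
  let ?w = "u_over_sin :: 'a fps" and ?v = "u_cot :: 'a fps"
  have "fps_X * fps_deriv (G m) =
      (fps_X * fps_deriv ?w) * ?v ^ m + ?w * (of_nat m * (fps_X * fps_deriv ?v) * ?v ^ (m - 1))"
    by (simp add: G_def fps_deriv_power algebra_simps fps_of_nat)
  also have "\<dots> = of_nat (Suc m) * G m - of_nat m * (fps_X ^ 2 * G (m - 1)) - of_nat (Suc m) * G (Suc m)"
    unfolding fps_deriv_u_over_sin fps_deriv_u_cot
    by (cases m) (simp_all add: G_def algebra_simps power2_eq_square)
  finally show ?thesis .
qed

text \<open>Take the coefficient of u^n with n = m + 1 - r. The operator u d/du multiplies it by n,
  which leaves the factor m + 1 - n = r, and u^2 lowers the index to m - 1 - r. For r \<ge> m this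
  shift leaves nothing, hence the 0.\<close>

lemma nth_u_over_sin_cot_power_Suc:
  fixes G :: "nat \<Rightarrow> 'a::field_char_0 fps"
  defines "G \<equiv> \<lambda>m. u_over_sin * u_cot ^ m"
  assumes "r \<le> Suc m"
  shows "of_nat (Suc m) * fps_nth (G (Suc m)) (Suc m - r) =
    of_nat r * fps_nth (G m) (Suc m - r) -
    of_nat m * (if r < m then fps_nth (G (m - 1)) (m - 1 - r) else 0)"
proof -
  define n where "n = Suc m - r"
  have ode: "fps_X * fps_deriv (G m) =
      of_nat (Suc m) * G m - of_nat m * (fps_X ^ 2 * G (m - 1)) - of_nat (Suc m) * G (Suc m)"
    unfolding G_def by (rule fps_deriv_u_over_sin_cot_power)
  have "fps_nth (fps_X * fps_deriv (G m)) n = of_nat n * fps_nth (G m) n"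
    by (cases n) simp_all
  moreover have "fps_nth (of_nat k * F) n = of_nat k * fps_nth F n" for k and F :: "'a fps"
    by (simp flip: fps_of_nat)
  ultimately have "of_nat (Suc m) * fps_nth (G (Suc m)) n =
      (of_nat (Suc m) - of_nat n) * fps_nth (G m) n -
      of_nat m * fps_nth (fps_X ^ 2 * G (m - 1)) n"
    using arg_cong[OF ode, of "\<lambda>F. fps_nth F n"]
    by (simp only: fps_sub_nth) (simp only: algebra_simps)
  moreover have "of_nat (Suc m) - of_nat n = (of_nat r :: 'a)"
    using assms(2) by (simp add: n_def of_nat_diff del: of_nat_Suc)
  moreover have "fps_nth (fps_X ^ 2 * G (m - 1)) n =
      (if r < m then fps_nth (G (m - 1)) (m - 1 - r) else 0)"
  proof -
    have "n < 2 \<longleftrightarrow> \<not> r < m" "n - 2 = m - 1 - r" using assms(2) by (auto simp: n_def)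
    thus ?thesis by (simp add: fps_X_power_mult_nth)
  qed
  ultimately show ?thesis by (simp add: n_def)
qed

section \<open>Comparison of the two recurrences\<close>

lemma nth_u_over_sin_cot_power:
  assumes "r \<le> m" "even (m - r)"
  shows "fps_nth (u_over_sin * u_cot ^ m :: 'a::field_char_0 fps) (m - r) =
    (- 1) ^ ((m - r) div 2) * (fact r / 2 ^ r) * coeff (q m) r"
  using assms
proof (induction m arbitrary: r rule: less_induct)
  case (less m)
  show ?case
  proof (cases m)
    case 0
    thus ?thesis using less.prems by (simp add: q_0 u_over_sin_nth_0)
  next
    case (Suc k)
    define G where "G = (\<lambda>m. u_over_sin * u_cot ^ m :: 'a fps)"
    define e where "e = (- 1 :: 'a) ^ ((m - r) div 2)"
    \<comment> \<open>Passing to (k, r - 1) keeps the difference, hence the sign, and r * (r - 1)! /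
      2^(r - 1) = 2 * r! / 2^r.\<close>
    have first: "of_nat r * fps_nth (G k) (Suc k - r) =
        e * (fact r / 2 ^ r) * (if r = 0 then 0 else 2 * coeff (q k) (r - 1))"
    proof (cases r)
      case (Suc s)
      have "fps_nth (G k) (k - s) = e * (fact s / 2 ^ s) * coeff (q k) s"
        using less.IH[of k s] less.prems Suc \<open>m = Suc k\<close> by (simp add: G_def e_def)
      thus ?thesis using Suc by (simp add: field_simps del: of_nat_Suc)
    qed simp
    \<comment> \<open>Passing to (k - 1, r) lowers the difference by 2, so the sign flips and
      absorbs the minus of the recurrence.\<close>
    have second: "- (of_nat k * (if r < k then fps_nth (G (k - 1)) (k - 1 - r) else 0)) =
        e * (fact r / 2 ^ r) * (of_nat k * coeff (q (k - 1)) r)"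
    proof (cases "r < k")
      case True
      have par: "even (k - 1 - r)" and half: "(m - r) div 2 = Suc ((k - 1 - r) div 2)"
        using True less.prems Suc by presburger+
      have "fps_nth (G (k - 1)) (k - 1 - r) =
          (- 1) ^ ((k - 1 - r) div 2) * (fact r / 2 ^ r) * coeff (q (k - 1)) r"
        unfolding G_def by (rule less.IH) (use True Suc par in auto)
      thus ?thesis using True by (simp add: e_def half)
    next
      case False
      \<comment> \<open>For positive k the degree bound applies, as k - 1 < r. For k = 0 the
        truncated \<open>k - 1\<close> is 0, and the factor \<open>of_nat k\<close> makes both sides
        vanish.\<close>
      hence "k \<noteq> 0 \<Longrightarrow> coeff (q (k - 1) :: 'a poly) r = 0"
        by (intro coeff_q_eq_0) auto
      thus ?thesis using False by (cases "k = 0") simp_all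
    qed
    have "of_nat (Suc k) * fps_nth (G (Suc k)) (Suc k - r) =
        of_nat r * fps_nth (G k) (Suc k - r) +
        - (of_nat k * (if r < k then fps_nth (G (k - 1)) (k - 1 - r) else 0))"
      using less.prems Suc unfolding G_def
      by (subst nth_u_over_sin_cot_power_Suc) (simp_all only: diff_conv_add_uminus)
    also have "\<dots> = e * (fact r / 2 ^ r) * (of_nat (Suc k) * coeff (q (Suc k)) r)"
      unfolding first second coeff_q_Suc by (simp only: distrib_left)
    finally have "of_nat (Suc k) * fps_nth (G (Suc k)) (Suc k - r) =
        of_nat (Suc k) * (e * (fact r / 2 ^ r) * coeff (q (Suc k)) r)"
      by (simp only: mult_ac)
    hence "fps_nth (G (Suc k)) (Suc k - r) = e * (fact r / 2 ^ r) * coeff (q (Suc k)) r"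
      by (subst (asm) mult_left_cancel) (simp_all del: of_nat_Suc)
    thus ?thesis using Suc by (simp add: G_def e_def)
  qed
qed

text \<open>The degree bound and the parity leave only the exponents m - 2j, each reached by exactly
  one j.\<close>

lemma q_eq_sum_monom:
  "q m = (\<Sum>j\<le>m div 2. monom (coeff (q m) (m - 2 * j)) (m - 2 * j) :: 'a::field_char_0 poly)"
proof (rule poly_eqI)
  fix r
  have "(\<Sum>j\<le>m div 2. coeff (monom (coeff (q m) (m - 2 * j)) (m - 2 * j)) r) = coeff (q m :: 'a poly) r"
  proof (cases "m < r \<or> odd (m + r)")
    case True
    hence "m - 2 * j \<noteq> r" if "j \<le> m div 2" for j using that by presburger
    thus ?thesis using True by (simp add: coeff_q_eq_0)
  next
    case False
    have "coeff (monom (coeff (q m) (m - 2 * j)) (m - 2 * j)) r =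
        (if j = (m - r) div 2 then coeff (q m :: 'a poly) r else 0)" if "j \<le> m div 2" for j
    proof -
      have "m - 2 * j = r \<longleftrightarrow> j = (m - r) div 2" using False that by presburger
      thus ?thesis by (cases "m - 2 * j = r") simp_all
    qed
    hence "(\<Sum>j\<le>m div 2. coeff (monom (coeff (q m) (m - 2 * j)) (m - 2 * j)) r) =
        (\<Sum>j\<le>m div 2. if j = (m - r) div 2 then coeff (q m :: 'a poly) r else 0)"
      by (intro sum.cong) auto
    also have "\<dots> = coeff (q m) r" by (simp add: div_le_mono)
    finally show ?thesis .
  qed
  thus "coeff (q m) r =
      coeff (\<Sum>j\<le>m div 2. monom (coeff (q m) (m - 2 * j)) (m - 2 * j) :: 'a poly) r"
    by (simp add: coeff_sum)
qed

theorem theorem6p3: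
  shows "(\<forall>m r. r \<le> m \<and> [r = m] (mod 2) \<longrightarrow>
            fps_nth (u_over_sin * u_cot ^ m :: 'a::field_char_0 fps) (m - r) =
            (- 1) ^ ((m - r) div 2) * (fact r / 2 ^ r) * coeff (q m) r) \<and>
         (\<forall>m. (q m :: 'a poly) =
            (\<Sum>j\<le>m div 2.
               monom ((- 1) ^ j * (2 ^ (m - 2 * j) / fact (m - 2 * j)) *
                      fps_nth (u_over_sin * u_cot ^ m) (2 * j)) (m - 2 * j)))"
proof (intro conjI allI impI)
  fix m r :: nat
  assume "r \<le> m \<and> [r = m] (mod 2)"
  hence "r \<le> m" "even (m - r)" by (simp, simp only: cong_def) presburger
  thus "fps_nth (u_over_sin * u_cot ^ m :: 'a fps) (m - r) =
      (- 1) ^ ((m - r) div 2) * (fact r / 2 ^ r) * coeff (q m) r"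
    by (rule nth_u_over_sin_cot_power)
next
  fix m
  have "coeff (q m) (m - 2 * j) = (- 1) ^ j * (2 ^ (m - 2 * j) / fact (m - 2 * j)) *
      fps_nth (u_over_sin * u_cot ^ m :: 'a fps) (2 * j)" if "j \<le> m div 2" for j
  proof -
    have "m - (m - 2 * j) = 2 * j" using that by auto
    \<comment> \<open>The sign is its own inverse, so it survives unchanged when the coefficient
      formula at r = m - 2j is solved for the coefficient of \<open>q m\<close>.\<close>
    moreover have "(- 1 :: 'a) ^ j * (- 1) ^ j = 1" by (simp flip: power_add mult_2)
    ultimately show ?thesis
      using nth_u_over_sin_cot_power[of "m - 2 * j" m, where 'a='a] by (simp add: field_simps)
  qed
  thus "(q m :: 'a poly) = (\<Sum>j\<le>m div 2.
      monom ((- 1) ^ j * (2 ^ (m - 2 * j) / fact (m - 2 * j)) *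
        fps_nth (u_over_sin * u_cot ^ m) (2 * j)) (m - 2 * j))"
    by (subst q_eq_sum_monom) (intro sum.cong, auto)
qed

end
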